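(* Let $f\in\mathbb{R}[x,y]$ be an admissible polynomial which is not a square in $\mathbb{R}[x,y]$, and let $s\ge1$ be an integer. Then $p_{2s}\big(\mathbb{R}[x,y,\sqrt{f(x,y)}]\big)=\infty$.
   Context: $\mathbb{R}[x,y,\sqrt{f}]$ denotes the ring $\mathbb{R}[x,y,z]/(z^2-f(x,y))$. Let $f\in\mathbb{R}[x,y]$ be non-constant with $f(0,0)=0$; let $d=\deg_y f$ and let $\alpha x^b y^d$ be the monomial of $f$ with nonzero coefficient $\alpha$ having $y$-degree $d$ and the largest possible $b$. Then $f$ is strictly admissible if either (a) $\alpha>0$ and $b,d$ are both even, or (b) $b$ or $d$ is odd. A polynomial $f$ is admissible if there is $M\in\mathrm{GL}_2(\mathbb{R})$ such that $f\circ M$ is strictly admissible. For a commutative ring $A$ with identity and a positive integer $m$, the $m$-th Pythagoras number $p_m(A)$ is the least positive integer $\ell$ such that every element of $A$ that is a sum of $m$-th powers of elements of $A$ can be written as a sum of at most $\ell$ $m$-th powers of elements of $A$; if no such $\ell$ exists, $p_m(A)=\infty$. *)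

theory Defs
  imports "HOL-Computational_Algebra.Polynomial" "HOL-Algebra.Ring" "HOL-Library.Extended_Nat"
begin

text \<open>Bivariate real polynomials R[x,y] are represented as real poly poly:
  the outer variable is y, the coefficients are polynomials in x.
  So f(x,y) = sum_j (coeff f j)(x) * y^j.\<close>

type_synonym bipoly = "real poly poly"

definition polyX :: bipoly where "polyX = [:[:0, 1:]:]"
definition polyY :: bipoly where "polyY = [:0, 1:]"

definition eval2 :: "bipoly \<Rightarrow> real \<Rightarrow> real \<Rightarrow> real" where
  "eval2 f x y = poly (map_poly (\<lambda>c. poly c x) f) y"

definition subst2 :: "bipoly \<Rightarrow> bipoly \<Rightarrow> bipoly \<Rightarrow> bipoly" where
  "subst2 g p q = poly (map_poly (\<lambda>c. poly (map_poly (\<lambda>a. [:[:a:]:]) c) p) g) q"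

definition compose_lin :: "bipoly \<Rightarrow> real \<Rightarrow> real \<Rightarrow> real \<Rightarrow> real \<Rightarrow> bipoly" where
  "compose_lin f m11 m12 m21 m22 =
     subst2 f (smult [:m11:] polyX + smult [:m12:] polyY)
              (smult [:m21:] polyX + smult [:m22:] polyY)"

definition nonconstant2 :: "bipoly \<Rightarrow> bool" where
  "nonconstant2 f \<longleftrightarrow> \<not> (\<exists>c. f = [:[:c:]:])"

text \<open>d = deg_y f, alpha x^b y^d the monomial of y-degree d with largest b.\<close>
definition strictly_admissible :: "bipoly \<Rightarrow> bool" where
  "strictly_admissible f \<longleftrightarrow> nonconstant2 f \<and> eval2 f 0 0 = 0 \<and>
     (let d = degree f; b = degree (lead_coeff f); \<alpha> = lead_coeff (lead_coeff f) in
       (\<alpha> > 0 \<and> even b \<and> even d) \<or> odd b \<or> odd d)"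

definition admissible :: "bipoly \<Rightarrow> bool" where
  "admissible f \<longleftrightarrow> (\<exists>m11 m12 m21 m22. m11 * m22 - m12 * m21 \<noteq> 0 \<and>
       strictly_admissible (compose_lin f m11 m12 m21 m22))"

text \<open>The ring R[x,y,z]/(z^2 - f): since z^2 - f is monic in z, every element
  is uniquely a + b z with a, b in R[x,y]; we represent it as the pair (a,b).\<close>
definition sqrt_ring :: "bipoly \<Rightarrow> (bipoly \<times> bipoly) ring" where
  "sqrt_ring f = \<lparr> carrier = UNIV,
     mult = (\<lambda>(a, b) (c, d). (a * c + f * b * d, a * d + b * c)),
     one = (1, 0),
     zero = (0, 0),
     add = (\<lambda>(a, b) (c, d). (a + c, b + d)) \<rparr>"

definition sum_of_powers_le :: "('a, 'b) ring_scheme \<Rightarrow> nat \<Rightarrow> nat \<Rightarrow> 'a \<Rightarrow> bool" where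
  "sum_of_powers_le A m l x \<longleftrightarrow> (\<exists>k\<le>l. \<exists>g. g \<in> {..<k} \<rightarrow> carrier A \<and>
       x = finsum A (\<lambda>i. g i [^]\<^bsub>A\<^esub> m) {..<k})"

definition sum_of_powers :: "('a, 'b) ring_scheme \<Rightarrow> nat \<Rightarrow> 'a \<Rightarrow> bool" where
  "sum_of_powers A m x \<longleftrightarrow> (\<exists>l. sum_of_powers_le A m l x)"

definition pythagoras_number :: "('a, 'b) ring_scheme \<Rightarrow> nat \<Rightarrow> enat" where
  "pythagoras_number A m =
     (let P = (\<lambda>l. l > 0 \<and> (\<forall>x\<in>carrier A. sum_of_powers A m x \<longrightarrow> sum_of_powers_le A m l x))
      in if \<exists>l. P l then enat (LEAST l. P l) else \<infinity>)"

end

theory Submission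
  imports Defs
begin

text \<open>Finitely many tangents to the parabola \<open>4 y = x\<^sup>2\<close>, indexed by a set \<open>T\<close> of slopes, meet
  pairwise. Let \<open>g\<^sub>t\<close> be the product of the affine forms of all tangents but the one with slope
  \<open>t\<close>, and \<open>F = \<Sum>t\<in>T. g\<^sub>t\<^bsup>2s\<^esup>\<close>. After a linear change of coordinates and a substitution
  \<open>y \<mapsto> y + x\<^sup>N\<close>, admissibility makes \<open>f\<close> grow at least linearly in \<open>x\<close> on \<open>\<bar>y\<bar> \<le> x\<^sup>2\<close>, \<open>x\<close> large,
  where the tangents meet. If \<open>F = \<Sum>k<l. (A\<^sub>k + B\<^sub>k \<surd>f)\<^bsup>2s\<^esup>\<close>, both signs of the root give
  \<open>\<bar>A\<^sub>k\<bar> \<le> \<bar>g\<^sub>t\<bar>\<close> and \<open>\<bar>B\<^sub>k\<bar> \<surd>f \<le> \<bar>g\<^sub>t\<bar>\<close> on the tangent with slope \<open>t\<close>, so there \<open>A\<^sub>k = a\<^sub>k\<^sub>t g\<^sub>t\<close> and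
  \<open>B\<^sub>k = 0\<close>; hence \<open>\<Sum>k<l. a\<^sub>k\<^sub>t\<^bsup>2s\<^esup> = 1\<close>. The leading terms at the intersection of two tangents along the
  vertical line give \<open>\<Sum>k<l. (a\<^sub>k\<^sub>t + a\<^sub>k\<^sub>u)\<^bsup>2s\<^esup> = 2\<close>, which is impossible when \<open>a\<^sub>k\<^sub>t\<close> and
  \<open>a\<^sub>k\<^sub>u\<close> have the same sign for all \<open>k\<close>. Such \<open>t \<noteq> u\<close> exist as soon as \<open>card T > 3\<^sup>l\<close>.\<close>

subsection \<open>Evaluation and substitution\<close>

text \<open>Putting a constant polynomial for y first makes evaluation a composite of two
  \<open>poly\<close>, so that the homomorphism rules of \<open>poly\<close> carry over.\<close>

lemma eval2_eq_poly_poly: "eval2 A x y = poly (poly A [:y:]) x"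
  unfolding eval2_def by (induction A) (auto simp: map_poly_pCons)

lemma eval2_simps [simp]:
  "eval2 0 x y = 0" "eval2 1 x y = 1"
  "eval2 (A + B) x y = eval2 A x y + eval2 B x y"
  "eval2 (A - B) x y = eval2 A x y - eval2 B x y"
  "eval2 (A * B) x y = eval2 A x y * eval2 B x y"
  "eval2 (A ^ n) x y = eval2 A x y ^ n"
  "eval2 (pCons c A) x y = poly c x + y * eval2 A x y"
  "eval2 (sum F I) x y = (\<Sum>i\<in>I. eval2 (F i) x y)"
  "eval2 (prod F I) x y = (\<Prod>i\<in>I. eval2 (F i) x y)"
  "eval2 (smult c A) x y = poly c x * eval2 A x y"
  "eval2 polyX x y = x" "eval2 polyY x y = y"
  by (simp_all add: eval2_eq_poly_poly poly_sum poly_prod polyX_def polyY_def)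

text \<open>\<open>poly A q\<close> is the restriction of \<open>A\<close> to the curve y = q(x),
  written as a polynomial in x. Restrictions to lines are expressed this way below.\<close>

lemma poly_poly_eq_eval2: "poly (poly A q) x = eval2 A x (poly q x)"
  by (induction A) (simp_all)

lemma isCont_eval2: "isCont (\<lambda>y. eval2 A x y) y0"
  unfolding eval2_def by (rule poly_isCont)

text \<open>Kept general in \<open>h\<close> because \<open>subst2\<close> uses it twice: for the
  embedding of the constants and for the substitution into the coefficients.\<close>

lemma poly_map_poly_hom:
  fixes h :: "'a::comm_ring_1 \<Rightarrow> 'b::comm_ring_1"
  assumes [simp]: "h 0 = 0" and add: "\<And>a b. h (a + b) = h a + h b"
    and mult: "\<And>a b. h (a * b) = h a * h b"
  shows "poly (map_poly h (A + B)) q = poly (map_poly h A) q + poly (map_poly h B) q"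
    and "poly (map_poly h (A * B)) q = poly (map_poly h A) q * poly (map_poly h B) q"
proof -
  have add': "poly (map_poly h (A + B)) q = poly (map_poly h A) q + poly (map_poly h B) q" for A B
  proof -
    have "map_poly h (A + B) = map_poly h A + map_poly h B"
      by (rule poly_eqI) (simp add: coeff_map_poly add)
    then show ?thesis by simp
  qed
  show "poly (map_poly h (A + B)) q = poly (map_poly h A) q + poly (map_poly h B) q"
    by (rule add')
  have sm: "poly (map_poly h (smult c B)) q = h c * poly (map_poly h B) q" for c B
    by (induction B) (auto simp: map_poly_pCons mult algebra_simps)
  show "poly (map_poly h (A * B)) q = poly (map_poly h A) q * poly (map_poly h B) q"
    by (induction A) (auto simp: map_poly_pCons mult_pCons_left add' sm algebra_simps)
qed

lemma subst2_add: "subst2 (A + B) p q = subst2 A p q + subst2 B p q"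
  and subst2_mult: "subst2 (A * B) p q = subst2 A p q * subst2 B p q"
  unfolding subst2_def by (intro poly_map_poly_hom; simp add: poly_map_poly_hom)+

lemma subst2_const: "subst2 [:[:a:]:] p q = [:[:a:]:]"
  by (cases "a = 0") (simp_all add: subst2_def map_poly_pCons)

lemma subst2_X: "subst2 polyX p q = p" and subst2_Y: "subst2 polyY p q = q"
  by (simp_all add: subst2_def map_poly_pCons polyX_def polyY_def flip: one_pCons)

lemma eval2_subst2: "eval2 (subst2 A p q) x y = eval2 A (eval2 p x y) (eval2 q x y)"
proof -
  have 1: "eval2 (poly (map_poly (\<lambda>a. [:[:a:]:]) c) p) x y = poly c (eval2 p x y)" for c
    by (induction c) (auto simp: map_poly_pCons)
  show ?thesis unfolding subst2_def
    by (induction A) (auto simp: map_poly_pCons 1)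
qed

section \<open>Algebra endomorphisms of R[x,y] and their surjectivity\<close>

definition bipoly_hom :: "(bipoly \<Rightarrow> bipoly) \<Rightarrow> bool" where
  "bipoly_hom \<phi> \<longleftrightarrow> (\<forall>A B. \<phi> (A + B) = \<phi> A + \<phi> B) \<and> (\<forall>A B. \<phi> (A * B) = \<phi> A * \<phi> B)
     \<and> (\<forall>a. \<phi> [:[:a:]:] = [:[:a:]:])"

lemma bipoly_hom_subst2: "bipoly_hom (\<lambda>A. subst2 A p q)"
  by (simp add: bipoly_hom_def subst2_add subst2_mult subst2_const)

text \<open>Horner's scheme, first in x for the coefficients, then in y.\<close>

lemma bipoly_generated:
  assumes c: "\<And>a. [:[:a:]:] \<in> S" and "polyX \<in> S" "polyY \<in> S"
    and add: "\<And>A B. A \<in> S \<Longrightarrow> B \<in> S \<Longrightarrow> A + B \<in> S"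
    and mult: "\<And>A B. A \<in> S \<Longrightarrow> B \<in> S \<Longrightarrow> A * B \<in> S"
  shows "A \<in> S"
proof -
  have 1: "[:p:] \<in> S" for p
  proof (induction p)
    case 0 then show ?case using c[of 0] by simp
  next
    case (pCons a p)
    have "[:pCons a p:] = [:[:a:]:] + polyX * [:p:]"
      by (simp add: polyX_def)
    then show ?case using pCons c assms(2) add mult by metis
  qed
  show ?thesis
  proof (induction A)
    case 0 then show ?case using 1[of 0] by simp
  next
    case (pCons p A)
    have "pCons p A = [:p:] + polyY * A"
      by (simp add: polyY_def)
    then show ?case using pCons 1 assms(3) add mult by metis
  qed
qed

lemma surj_bipoly_hom:
  assumes "bipoly_hom \<phi>" "polyX \<in> range \<phi>" "polyY \<in> range \<phi>"
  shows "surj \<phi>"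
proof -
  have "A \<in> range \<phi>" for A
  proof (rule bipoly_generated)
    show "[:[:a:]:] \<in> range \<phi>" for a
      using assms(1) unfolding bipoly_hom_def by (metis rangeI)
    show "A + B \<in> range \<phi>" if "A \<in> range \<phi>" "B \<in> range \<phi>" for A B
    proof -
      from that obtain A' B' where "A = \<phi> A'" "B = \<phi> B'" by auto
      then have "A + B = \<phi> (A' + B')" using assms(1) by (simp add: bipoly_hom_def)
      then show ?thesis by simp
    qed
    show "A * B \<in> range \<phi>" if "A \<in> range \<phi>" "B \<in> range \<phi>" for A B
    proof -
      from that obtain A' B' where "A = \<phi> A'" "B = \<phi> B'" by auto
      then have "A * B = \<phi> (A' * B')" using assms(1) by (simp add: bipoly_hom_def)
      then show ?thesis by simp
    qed
  qed (use assms in auto)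
  then show ?thesis by auto
qed

subsection \<open>Bounds for univariate polynomials\<close>

text \<open>Otherwise \<open>q\<close> or \<open>- q\<close> has positive leading coefficient.
  Subtracting the constant \<open>C\<close> does not change it, so the difference is positive near
  infinity, against the bound.\<close>

lemma poly_bounded_imp_const:
  fixes q :: "real poly"
  assumes "\<And>x. x \<ge> r \<Longrightarrow> \<bar>poly q x\<bar> \<le> C"
  shows "degree q = 0"
proof (rule ccontr)
  assume deg: "degree q \<noteq> 0"
  have *: False if lc: "lead_coeff p > 0" and dg: "degree p \<noteq> 0" and le: "\<And>x. x \<ge> r \<Longrightarrow> poly p x \<le> C" for p :: "real poly"
  proof -
    have "degree (p - [:C:]) = degree p"
      using degree_add_eq_left[of "- [:C:]" p] dg by (metis degree_minus degree_pCons_0 diff_conv_add_uminus neq0_conv)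
    then have "lead_coeff (p - [:C:]) = lead_coeff p"
      using dg by (simp add: coeff_pCons split: nat.splits)
    then obtain n where n: "\<And>x. x \<ge> n \<Longrightarrow> lead_coeff p \<le> poly p x - C"
      using poly_pinfty_gt_lc[of "p - [:C:]"] lc by (auto simp del: coeff_diff)
    have "lead_coeff p \<le> poly p (max n r) - C" by (rule n) simp
    moreover have "poly p (max n r) \<le> C" by (rule le) simp
    ultimately show False using lc by linarith
  qed
  have "lead_coeff q > 0 \<or> lead_coeff (- q) > 0"
    using deg by (metis degree_0 leading_coeff_0_iff lead_coeff_minus neg_0_less_iff_less linorder_neqE_linordered_idom)
  then show False
  proof
    assume "lead_coeff q > 0"
    then show False by (rule *) (use deg assms in \<open>auto simp: abs_le_iff\<close>)
  next
    assume "lead_coeff (- q) > 0"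
    then show False by (rule *) (use deg assms in \<open>auto simp: abs_le_iff\<close>)
  qed
qed

lemma prod_linear_dvd_poly:
  fixes p :: "'a::idom poly"
  assumes "finite R" "\<And>r. r \<in> R \<Longrightarrow> poly p r = 0"
  shows "(\<Prod>r\<in>R. [:- r, 1:]) dvd p"
  using assms
proof (induction R arbitrary: p rule: finite_induct)
  case (insert r R)
  have "(\<Prod>r\<in>R. [:- r, 1:]) dvd p" using insert by blast
  then obtain q where q: "p = (\<Prod>r\<in>R. [:- r, 1:]) * q" by (rule dvdE)
  have "poly q r = 0"
    using insert.prems[of r] insert.hyps by (auto simp: q poly_prod)
  then show ?case
    unfolding poly_eq_0_iff_dvd prod.insert[OF insert.hyps] q
    by (subst mult.commute) (rule mult_dvd_mono[OF dvd_refl])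
qed simp

text \<open>A polynomial dominated near infinity and at its zeros by a product of distinct
  linear factors has a bounded quotient, hence a constant one.\<close>

lemma poly_dominated_by_prod_linear:
  fixes p :: "real poly"
  assumes "finite R" "R \<subseteq> {r..}"
    and dom: "\<And>x. x \<ge> r \<Longrightarrow> \<bar>poly p x\<bar> \<le> C * \<bar>\<Prod>\<rho>\<in>R. (x - \<rho>)\<bar>"
  obtains a where "p = smult a (\<Prod>\<rho>\<in>R. [:- \<rho>, 1:])"
proof -
  let ?G = "\<Prod>\<rho>\<in>R. [:- \<rho>, 1:]"
  have G: "poly ?G x = (\<Prod>\<rho>\<in>R. (x - \<rho>))" for x
    by (simp add: poly_prod)
  have "?G dvd p"
  proof (rule prod_linear_dvd_poly[OF assms(1)])
    fix \<rho> assume "\<rho> \<in> R"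
    then have "(\<Prod>\<rho>'\<in>R. (\<rho> - \<rho>')) = 0" using assms(1) by (auto intro: prod_zero)
    then show "poly p \<rho> = 0" using dom[of \<rho>] \<open>\<rho> \<in> R\<close> assms(2) by auto
  qed
  then obtain q where q: "p = ?G * q" by (rule dvdE)
  have "degree q = 0"
  proof (rule poly_bounded_imp_const)
    \<comment> \<open>To the right of all roots the product is nonzero and can be cancelled.
      Inserting \<open>r\<close> keeps \<open>x\<close> in the range of the bound and covers empty
      \<open>R\<close>.\<close>
    fix x assume x: "x \<ge> Max (insert r R) + 1"
    have le: "\<rho> \<le> Max (insert r R)" if "\<rho> \<in> insert r R" for \<rho>
      using that assms(1) by (intro Max_ge) auto
    have "x \<ge> r" "\<And>\<rho>. \<rho> \<in> R \<Longrightarrow> x > \<rho>"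
      using x le by force+
    then have "\<bar>poly ?G x\<bar> > 0" using assms(1) by (auto simp: G)
    moreover have "\<bar>poly ?G x\<bar> * \<bar>poly q x\<bar> \<le> C * \<bar>poly ?G x\<bar>"
      using dom[OF \<open>x \<ge> r\<close>] by (simp only: q poly_mult abs_mult G)
    ultimately show "\<bar>poly q x\<bar> \<le> C" by (simp add: mult.commute)
  qed
  then obtain a where "q = [:a:]" by (rule degree_eq_zeroE)
  with q that show thesis by simp
qed

lemma abs_poly_le_power_degree:
  fixes p :: "real poly"
  assumes "\<bar>x\<bar> \<ge> 1"
  shows "\<bar>poly p x\<bar> \<le> (\<Sum>i\<le>degree p. \<bar>coeff p i\<bar>) * \<bar>x\<bar> ^ degree p"
proof -
  have "\<bar>poly p x\<bar> \<le> (\<Sum>i\<le>degree p. \<bar>coeff p i\<bar> * \<bar>x\<bar> ^ i)"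
    unfolding poly_altdef by (rule order_trans[OF sum_abs]) (simp add: abs_mult power_abs)
  also have "\<dots> \<le> (\<Sum>i\<le>degree p. \<bar>coeff p i\<bar> * \<bar>x\<bar> ^ degree p)"
    using assms by (intro sum_mono mult_left_mono power_increasing) auto
  finally show ?thesis by (simp add: sum_distrib_right)
qed

lemma eval2_altdef: "eval2 A x y = (\<Sum>i\<le>degree A. poly (coeff A i) x * y ^ i)"
  by (simp add: eval2_eq_poly_poly poly_altdef[of A] poly_sum)

subsection \<open>Growth of strictly admissible polynomials\<close>

text \<open>The signs make the coefficient of the top power of y positive for large x. The shift by
  x^N makes the second argument so large that this power dominates all lower ones, uniformly in
  \<bar>y\<bar> \<le> x^2.\<close>

lemma strictly_admissible_growth:
  assumes "strictly_admissible g"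
  obtains \<epsilon> \<delta> \<kappa> r :: real and N :: nat
  where "\<epsilon>\<^sup>2 = 1" "\<delta>\<^sup>2 = 1" "\<kappa> > 0"
    "\<And>x y. x \<ge> r \<Longrightarrow> \<bar>y\<bar> \<le> x\<^sup>2 \<Longrightarrow> \<kappa> * x \<le> eval2 g (\<epsilon> * x) (\<delta> * (y + x ^ N))"
proof -
  define d where "d = degree g"
  define b where "b = degree (lead_coeff g)"
  define \<alpha> where "\<alpha> = lead_coeff (lead_coeff g)"
  have nc: "nonconstant2 g" and adm: "\<alpha> > 0 \<and> even b \<and> even d \<or> odd b \<or> odd d"
    using assms by (auto simp: strictly_admissible_def Let_def d_def b_def \<alpha>_def)
  have "g \<noteq> 0" using nc by (auto simp: nonconstant2_def)
  then have "\<alpha> \<noteq> 0" by (simp add: \<alpha>_def)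
  \<comment> \<open>If \<alpha> < 0, admissibility makes one exponent odd, and the sign of that
    variable is flipped.\<close>
  obtain \<epsilon> \<delta> :: real where sq: "\<epsilon>\<^sup>2 = 1" "\<delta>\<^sup>2 = 1" and pos: "\<alpha> * \<epsilon> ^ b * \<delta> ^ d > 0"
  proof (cases "\<alpha> > 0")
    case True then show ?thesis using that[of 1 1] by simp
  next
    case False
    then have "\<alpha> < 0" using \<open>\<alpha> \<noteq> 0\<close> by simp
    then show ?thesis using that[of "-1" 1] that[of 1 "-1"] adm by (cases "odd b") auto
  qed
  have abs1: "\<bar>\<epsilon>\<bar> = 1" "\<bar>\<delta>\<bar> = 1" using sq by (simp_all add: power2_eq_1_iff abs_if) auto
  define \<mu> where "\<mu> = \<alpha> * \<epsilon> ^ b * \<delta> ^ d"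
  define c where "c = smult (\<delta> ^ d) (pcompose (lead_coeff g) [:0, \<epsilon>:])"
  have \<mu>: "\<mu> > 0" using pos by (simp add: \<mu>_def)
  have c: "poly c x = \<delta> ^ d * poly (lead_coeff g) (\<epsilon> * x)" for x
    by (simp add: c_def poly_pcompose mult.commute)
  have "\<epsilon> \<noteq> 0" using abs1 by auto
  then have lc: "lead_coeff c = \<mu>"
    by (simp add: c_def lead_coeff_comp \<mu>_def \<alpha>_def b_def)
  show thesis
  proof (cases "d = 0")
    case True
    then obtain c0 where g: "g = [:c0:]" unfolding d_def by (auto elim: degree_eq_zeroE)
    have "degree c0 \<noteq> 0" using nc unfolding g nonconstant2_def by (metis degree_eq_zeroE)
    moreover have "degree c = degree c0" using \<open>\<epsilon> \<noteq> 0\<close> abs1 by (auto simp: c_def g degree_pcompose)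
    \<comment> \<open>Here \<open>g\<close> depends on x alone. Splitting off the constant term
      leaves x times a polynomial that is eventually at least \<mu>; half of this slope is given up
      to absorb \<open>a0\<close>.\<close>
    ultimately obtain a0 c1 where c1: "c = pCons a0 c1" "c1 \<noteq> 0"
      by (metis degree_pCons_0 pCons_cases)
    then have "lead_coeff c1 = \<mu>" using lc by simp
    then obtain n where n: "\<And>x. x \<ge> n \<Longrightarrow> \<mu> \<le> poly c1 x"
      using poly_pinfty_gt_lc[of c1] \<mu> by auto
    have "\<mu> / 2 * x \<le> eval2 g (\<epsilon> * x) (\<delta> * (y + x ^ 0))" if x: "x \<ge> max n (max 0 (2 * \<bar>a0\<bar> / \<mu>))" for x y
    proof -
      have "2 * \<bar>a0\<bar> \<le> \<mu> * x" using x \<mu> by (simp add: field_simps)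
      moreover have "x * \<mu> \<le> x * poly c1 x" using x n by (intro mult_left_mono) auto
      moreover have "eval2 g (\<epsilon> * x) (\<delta> * (y + x ^ 0)) = a0 + x * poly c1 x"
        using c[of x] True by (simp add: g c1)
      ultimately show ?thesis by (simp add: field_simps)
    qed
    then show thesis using \<mu> sq by (intro that[of \<epsilon> \<delta> "\<mu> / 2" "max n (max 0 (2 * \<bar>a0\<bar> / \<mu>))" 0]) auto
  next
    case False
    obtain n where n: "\<And>x. x \<ge> n \<Longrightarrow> \<mu> \<le> poly c x"
      using poly_pinfty_gt_lc[of c] \<mu> lc by auto
    \<comment> \<open>For x \<ge> 1 the lower terms add up to at most K x^m w^(d-1), where w \<ge> 1
      is the shifted argument. The exponent m + 3 gives w \<ge> x + x^m K/\<mu> despite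
      \<bar>y\<bar> \<le> x^2, hence \<mu> w - K x^m \<ge> \<mu> x.\<close>
    define K where "K = (\<Sum>j<d. \<Sum>i\<le>degree (coeff g j). \<bar>coeff (coeff g j) i\<bar>)"
    define m where "m = (\<Sum>j<d. degree (coeff g j))"
    have K0: "K \<ge> 0" unfolding K_def by (intro sum_nonneg) auto
    have "\<mu> * x \<le> eval2 g (\<epsilon> * x) (\<delta> * (y + x ^ (m + 3)))"
      if x: "x \<ge> max n (3 + K / \<mu>)" and y: "\<bar>y\<bar> \<le> x\<^sup>2" for x y
    proof -
      have x3: "x \<ge> 3" "x \<ge> K / \<mu>" using x K0 \<mu> by (auto intro: order_trans[rotated])
      define w where "w = y + x ^ (m + 3)"
      have xm: "x ^ m \<ge> 1" using x3 by (intro one_le_power) auto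
      have "x * x \<ge> 3 * x" "x * (x * x) \<ge> 3 * (x * x)" using x3 by (auto intro: mult_right_mono)
      then have "x * (x * x) \<ge> x * x + x + x" using x3 by (smt (verit))
      then have "x * (x * x) \<ge> x\<^sup>2 + x + K / \<mu>" using x3 by (simp add: power2_eq_square)
      then have "x ^ m * (x * (x * x)) \<ge> x ^ m * (x\<^sup>2 + x + K / \<mu>)"
        using xm by (intro mult_left_mono) auto
      moreover have "x ^ m * (x\<^sup>2 + x) \<ge> 1 * (x\<^sup>2 + x)"
        using xm x3 by (intro mult_right_mono) auto
      moreover have "x ^ (m + 3) = x ^ m * (x * (x * x))"
        by (simp add: power_add power3_eq_cube)
      ultimately have wx: "w \<ge> x + x ^ m * (K / \<mu>)" using y unfolding w_def
        by (simp add: algebra_simps abs_le_iff)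
      have "x ^ m * (K / \<mu>) \<ge> 0" using xm K0 \<mu> by simp
      then have w1: "w \<ge> 1" using wx x3 by linarith
      have big: "\<mu> * w - K * x ^ m \<ge> \<mu> * x"
      proof -
        have "\<mu> * (x ^ m * (K / \<mu>)) = K * x ^ m" using \<mu> by simp
        then show ?thesis
          using mult_left_mono[OF wx, of \<mu>] \<mu> unfolding distrib_left by linarith
      qed
      have low: "\<bar>\<Sum>j<d. poly (coeff g j) (\<epsilon> * x) * (\<delta> * w) ^ j\<bar> \<le> K * x ^ m * w ^ (d - 1)"
      proof -
        have "\<bar>\<Sum>j<d. poly (coeff g j) (\<epsilon> * x) * (\<delta> * w) ^ j\<bar>
          \<le> (\<Sum>j<d. \<bar>poly (coeff g j) (\<epsilon> * x) * (\<delta> * w) ^ j\<bar>)"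
          by (rule sum_abs)
        also have "\<dots> \<le> (\<Sum>j<d. (\<Sum>i\<le>degree (coeff g j). \<bar>coeff (coeff g j) i\<bar>) * (x ^ m * w ^ (d - 1)))"
        proof (rule sum_mono)
          fix j assume j: "j \<in> {..<d}"
          let ?S = "\<Sum>i\<le>degree (coeff g j). \<bar>coeff (coeff g j) i\<bar>"
          have "degree (coeff g j) \<le> m"
            unfolding m_def using j by (intro member_le_sum) auto
          then have "x ^ degree (coeff g j) \<le> x ^ m"
            using x3 by (intro power_increasing) auto
          moreover have "\<bar>poly (coeff g j) (\<epsilon> * x)\<bar> \<le> ?S * x ^ degree (coeff g j)"
            using abs_poly_le_power_degree[of "\<epsilon> * x" "coeff g j"] x3 abs1 by (simp add: abs_mult)
          moreover have "?S \<ge> 0" by (intro sum_nonneg) auto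
          ultimately have 1: "\<bar>poly (coeff g j) (\<epsilon> * x)\<bar> \<le> ?S * x ^ m"
            by (meson mult_left_mono order_trans)
          have 2: "\<bar>(\<delta> * w) ^ j\<bar> \<le> w ^ (d - 1)"
            using j w1 abs1 by (simp add: power_abs abs_mult power_mult_distrib) (intro power_increasing; simp)
          show "\<bar>poly (coeff g j) (\<epsilon> * x) * (\<delta> * w) ^ j\<bar> \<le> ?S * (x ^ m * w ^ (d - 1))"
            using mult_mono[OF 1 2] \<open>?S \<ge> 0\<close> xm by (simp add: abs_mult mult.assoc)
        qed
        finally show ?thesis by (simp add: K_def sum_distrib_right mult.assoc)
      qed
      have wd: "w ^ d = w * w ^ (d - 1)" using False by (simp flip: power_Suc)
      have "\<mu> * x \<ge> 0" using \<mu> x3 by simp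
      then have "\<mu> * x * 1 \<le> (\<mu> * w - K * x ^ m) * w ^ (d - 1)"
        using big w1 by (intro mult_mono) auto
      also have "\<dots> = \<mu> * w ^ d - K * x ^ m * w ^ (d - 1)"
        by (simp add: wd algebra_simps)
      also have "\<dots> \<le> poly c x * w ^ d + (\<Sum>j<d. poly (coeff g j) (\<epsilon> * x) * (\<delta> * w) ^ j)"
      proof -
        have "\<mu> * w ^ d \<le> poly c x * w ^ d" using n[of x] x w1 by (intro mult_right_mono) auto
        then show ?thesis using low by (simp only: abs_le_iff) linarith
      qed
      also have "\<dots> = eval2 g (\<epsilon> * x) (\<delta> * w)"
        by (simp add: eval2_altdef lessThan_Suc_atMost[symmetric] c d_def power_mult_distrib)
      finally show ?thesis by (simp add: w_def)
    qed
    then show thesis using \<mu> sq by (intro that[of \<epsilon> \<delta> \<mu> "max n (3 + K / \<mu>)" "m + 3"]) auto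
  qed
qed

subsection \<open>Products of tangents to a parabola\<close>

text \<open>The line \<open>y = t x - t\<^sup>2\<close> is tangent to the parabola \<open>4 y = x\<^sup>2\<close>; the tangents with
  slopes \<open>t\<close> and \<open>u\<close> meet in the point \<open>(t + u, t u)\<close>.\<close>

definition tangent_prod :: "real set \<Rightarrow> bipoly" where
  "tangent_prod T = (\<Prod>j\<in>T. [:[:j\<^sup>2, - j:], 1:])"

lemma eval2_tangent_prod: "eval2 (tangent_prod T) x y = (\<Prod>j\<in>T. (y - j * x + j\<^sup>2))"
  unfolding tangent_prod_def eval2_simps by (intro prod.cong) (auto simp: algebra_simps)

text \<open>On this tangent the form with slope \<open>j\<close> becomes (t - j)(x - (t + j)), with
  its zero at the intersection of the two tangents.\<close>

lemma eval2_tangent_prod_tangent: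
  "eval2 (tangent_prod T) x (t * x - t\<^sup>2) = (\<Prod>j\<in>T. (t - j)) * (\<Prod>j\<in>T. (x - (t + j)))"
  unfolding eval2_tangent_prod prod.distrib[symmetric]
  by (intro prod.cong) (auto simp: algebra_simps power2_eq_square)

lemma eval2_tangent_prod_intersection:
  "eval2 (tangent_prod T) (t + u) (t * u) = (\<Prod>j\<in>T. (t - j)) * (\<Prod>j\<in>T. (u - j))"
  unfolding eval2_tangent_prod prod.distrib[symmetric]
  by (intro prod.cong) (auto simp: algebra_simps power2_eq_square)

lemma eval2_tangent_prod_insert:
  assumes "finite T" "t \<notin> T"
  shows "eval2 (tangent_prod (insert t T)) (t + u) y = (y - t * u) * eval2 (tangent_prod T) (t + u) y"
  using assms unfolding eval2_tangent_prod by (simp add: algebra_simps power2_eq_square)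

text \<open>Since j \<ge> 0, the zeros t + j lie in the range x \<ge> t of the bound, so
  \<open>poly_dominated_by_prod_linear\<close> applies to the restriction.\<close>

lemma poly_tangent_dominated:
  assumes "finite S" "\<And>j. j \<in> S \<Longrightarrow> j \<ge> 0"
    and dom: "\<And>x. x \<ge> t \<Longrightarrow> \<bar>eval2 A x (t * x - t\<^sup>2)\<bar> \<le> C * \<bar>eval2 (tangent_prod S) x (t * x - t\<^sup>2)\<bar>"
  shows "\<exists>a. poly A [:- (t\<^sup>2), t:] = smult a (\<Prod>j\<in>S. [:- (t + j), 1:])"
proof -
  have reindex: "(\<Prod>\<rho>\<in>(+) t ` S. h \<rho>) = (\<Prod>j\<in>S. h (t + j))" for h :: "real \<Rightarrow> 'b::comm_monoid_mult"
    by (simp add: prod.reindex)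
  obtain a where "poly A [:- (t\<^sup>2), t:] = smult a (\<Prod>\<rho>\<in>(+) t ` S. [:- \<rho>, 1:])"
  proof (rule poly_dominated_by_prod_linear[of "(+) t ` S" t "poly A [:- (t\<^sup>2), t:]" "C * \<bar>\<Prod>j\<in>S. (t - j)\<bar>"])
    show "finite ((+) t ` S)" "(+) t ` S \<subseteq> {t..}" using assms by auto
    show "\<bar>poly (poly A [:- (t\<^sup>2), t:]) x\<bar> \<le> C * \<bar>\<Prod>j\<in>S. (t - j)\<bar> * \<bar>\<Prod>\<rho>\<in>(+) t ` S. (x - \<rho>)\<bar>" if "x \<ge> t" for x
      using dom[OF that] unfolding eval2_tangent_prod_tangent abs_mult reindex
      by (simp add: poly_poly_eq_eval2 mult.assoc mult.commute[of x])
  qed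
  then show ?thesis unfolding reindex by blast
qed

text \<open>Writing \<open>A = (y - t u) D + (x - (t + u)) c\<close>, the restrictions of \<open>A\<close> to the two tangents
  determine \<open>t D + c\<close> and \<open>u D + c\<close> at the intersection point, hence \<open>D\<close>, the derivative
  of \<open>A\<close> in the vertical direction.\<close>

lemma vertical_quotient_at_intersection:
  assumes "finite S" "t \<notin> S" "u \<notin> S" "t \<noteq> u"
    and t: "poly A [:- (t\<^sup>2), t:] = smult a (\<Prod>j\<in>insert u S. [:- (t + j), 1:])"
    and u: "poly A [:- (u\<^sup>2), u:] = smult b (\<Prod>j\<in>insert t S. [:- (u + j), 1:])"
  obtains D where "\<And>y. eval2 A (t + u) y = (y - t * u) * eval2 D (t + u) y"
    "(t - u) * eval2 D (t + u) (t * u) = a * (\<Prod>j\<in>S. (u - j)) - b * (\<Prod>j\<in>S. (t - j))"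
proof -
  define D where "D = synthetic_div A [:t * u:]"
  have A: "A = [:- [:t * u:], 1:] * D + [:poly A [:t * u:]:]"
    unfolding D_def by (rule synthetic_div_correct'[symmetric])
  have A_eq: "poly A q = (q - [:t * u:]) * poly D q + poly A [:t * u:]" for q
    using arg_cong[OF A, of "\<lambda>p. poly p q"] by (simp add: algebra_simps)
  \<comment> \<open>\<open>A\<close> vanishes at the intersection point, because its restriction to
    the first tangent has the factor with j = u. So x - (t + u) divides the remainder.\<close>
  have "poly (poly A [:t * u:]) (t + u) = poly (poly A [:- (t\<^sup>2), t:]) (t + u)"
    by (simp add: poly_poly_eq_eval2 algebra_simps power2_eq_square)
  also have "\<dots> = 0" using assms(1,2,3) by (simp add: t algebra_simps)
  finally obtain c where c: "poly A [:t * u:] = [:- (t + u), 1:] * c"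
    unfolding poly_eq_0_iff_dvd by (rule dvdE)
  \<comment> \<open>On the tangent y - t u becomes t (x - (t + u)), so x - (t + u) cancels.\<close>
  have "[:- (t + u), 1:] * (smult t (poly D [:- (t\<^sup>2), t:]) + c) = poly A [:- (t\<^sup>2), t:]"
    unfolding A_eq[of "[:- (t\<^sup>2), t:]"] c
    by (simp add: algebra_simps power2_eq_square smult_add_right smult_diff_right smult_diff_left smult_add_left)
  also have "\<dots> = [:- (t + u), 1:] * smult a (\<Prod>j\<in>S. [:- (t + j), 1:])"
    unfolding t prod.insert[OF assms(1,3)] by (simp only: mult_smult_right)
  finally have "smult t (poly D [:- (t\<^sup>2), t:]) + c = smult a (\<Prod>j\<in>S. [:- (t + j), 1:])"
    by (subst (asm) mult_left_cancel) auto
  from arg_cong[OF this, of "\<lambda>p. poly p (t + u)"]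
  have 1: "t * eval2 D (t + u) (t * u) + poly c (t + u) = a * (\<Prod>j\<in>S. (u - j))"
    by (simp add: poly_poly_eq_eval2 poly_prod algebra_simps power2_eq_square)
  have "[:- (t + u), 1:] * (smult u (poly D [:- (u\<^sup>2), u:]) + c) = poly A [:- (u\<^sup>2), u:]"
    unfolding A_eq[of "[:- (u\<^sup>2), u:]"] c
    by (simp add: algebra_simps power2_eq_square smult_add_right smult_diff_right smult_diff_left smult_add_left)
  also have "\<dots> = [:- (t + u), 1:] * smult b (\<Prod>j\<in>S. [:- (u + j), 1:])"
    unfolding u prod.insert[OF assms(1,2)] by (simp only: mult_smult_right add.commute[of u t])
  finally have "smult u (poly D [:- (u\<^sup>2), u:]) + c = smult b (\<Prod>j\<in>S. [:- (u + j), 1:])"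
    by (subst (asm) mult_left_cancel) auto
  from arg_cong[OF this, of "\<lambda>p. poly p (t + u)"]
  have 2: "u * eval2 D (t + u) (t * u) + poly c (t + u) = b * (\<Prod>j\<in>S. (t - j))"
    by (simp add: poly_poly_eq_eval2 poly_prod algebra_simps power2_eq_square)
  show thesis
  proof (rule that)
    show "eval2 A (t + u) y = (y - t * u) * eval2 D (t + u) y" for y
      using A_eq[of "[:y:]"] by (simp add: eval2_eq_poly_poly c algebra_simps)
    show "(t - u) * eval2 D (t + u) (t * u) = a * (\<Prod>j\<in>S. (u - j)) - b * (\<Prod>j\<in>S. (t - j))"
      using 1 2 by (simp add: algebra_simps)
  qed
qed

text \<open>For positive numbers, expand (x + y)(x + y)^n and compare termwise; negative ones reduce
  to this because the exponent is even. If one number is 0, equal signs make both 0.\<close>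

lemma power_sum_le_power_add_same_sgn:
  fixes a b :: real
  assumes "sgn a = sgn b" "s \<ge> 1"
  shows "a ^ (2 * s) + b ^ (2 * s) \<le> (a + b) ^ (2 * s)"
    and "a \<noteq> 0 \<Longrightarrow> a ^ (2 * s) + b ^ (2 * s) < (a + b) ^ (2 * s)"
proof -
  obtain n where n: "2 * s = Suc n" "n > 0" using assms(2) by (cases "2 * s") auto
  have pos: "x ^ Suc n + y ^ Suc n < (x + y) ^ Suc n" if "x > 0" "y > 0" for x y :: real
  proof -
    have "x ^ n < (x + y) ^ n" "y ^ n < (x + y) ^ n"
      using that n by (auto intro!: power_strict_mono)
    then have "x * x ^ n + y * y ^ n < x * (x + y) ^ n + y * (x + y) ^ n"
      using that by (intro add_strict_mono mult_strict_left_mono)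
    then show ?thesis by (simp add: algebra_simps)
  qed
  show *: "a ^ (2 * s) + b ^ (2 * s) < (a + b) ^ (2 * s)" if "a \<noteq> 0"
  proof (cases "a > 0")
    case True
    then have "b > 0" using assms(1) by (metis sgn_greater)
    then show ?thesis using pos True n by simp
  next
    case False
    then have "a < 0" "b < 0" using that assms(1) by (metis linorder_neqE_linordered_idom, metis linorder_neqE_linordered_idom sgn_less)
    then have "(- a) ^ (2 * s) + (- b) ^ (2 * s) < (- a + - b) ^ (2 * s)" unfolding n by (intro pos) auto
    moreover have "(- z) ^ (2 * s) = z ^ (2 * s)" for z :: real by simp
    ultimately show ?thesis by (simp only: minus_add_distrib[symmetric])
  qed
  show "a ^ (2 * s) + b ^ (2 * s) \<le> (a + b) ^ (2 * s)"
    using * assms by (cases "a = 0") (auto simp: sgn_0_0 power_0_left dest: sym)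
qed

subsection \<open>A lower bound for the number of powers\<close>

text \<open>Pigeonhole on the 3^l vectors of signs -1, 0, 1.\<close>

lemma exists_same_sgn_pattern:
  fixes a :: "nat \<Rightarrow> 'i \<Rightarrow> real"
  assumes "finite T" "card T > 3 ^ l"
  obtains t u where "t \<in> T" "u \<in> T" "t \<noteq> u" "\<And>k. k < l \<Longrightarrow> sgn (a k t) = sgn (a k u)"
proof -
  let ?f = "\<lambda>t. \<lambda>k\<in>{..<l}. sgn (a k t)"
  let ?P = "{..<l} \<rightarrow>\<^sub>E {-1, 0, 1 :: real}"
  have "sgn z \<in> {-1, 0, 1}" for z :: real by (simp add: sgn_real_def)
  then have "?f ` T \<subseteq> ?P" by (intro image_subsetI PiE_I) auto
  then have "card (?f ` T) \<le> card ?P"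
    by (intro card_mono finite_PiE) auto
  also have "\<dots> = 3 ^ l" by (simp add: card_PiE numeral_3_eq_3)
  finally have "\<not> inj_on ?f T" using assms card_image[of ?f T] by auto
  then obtain t u where tu: "t \<in> T" "u \<in> T" "t \<noteq> u" "?f t = ?f u" by (auto simp: inj_on_def)
  have "sgn (a k t) = sgn (a k u)" if "k < l" for k
    using fun_cong[OF tu(4), of k] that by simp
  with tu that show thesis by blast
qed

text \<open>Used to evaluate an identity at a point after cancelling a factor that vanishes
  there.\<close>

lemma isCont_eq_zero_of_eventually:
  fixes h :: "real \<Rightarrow> real"
  assumes "isCont h a" "\<forall>\<^sub>F y in at a. h y = 0"
  shows "h a = 0"
proof (rule tendsto_unique)
  show "(h \<longlongrightarrow> h a) (at a)" using assms(1) by (simp add: isCont_def)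
  show "(h \<longlongrightarrow> 0) (at a)" using assms(2) by (rule tendsto_eventually)
qed simp

lemma tangent_power_sum_length:
  fixes g :: bipoly and A B :: "nat \<Rightarrow> bipoly" and T :: "real set"
  assumes s: "s \<ge> 1" and \<kappa>: "\<kappa> > 0"
    and growth: "\<And>x y. x \<ge> r \<Longrightarrow> \<bar>y\<bar> \<le> x\<^sup>2 \<Longrightarrow> \<kappa> * x \<le> eval2 g x y"
    and T: "finite T" "\<And>t. t \<in> T \<Longrightarrow> t \<ge> 1" "\<And>t. t \<in> T \<Longrightarrow> t \<ge> r"
    and eq: "\<And>x y \<sigma>. \<sigma>\<^sup>2 = 1 \<Longrightarrow> eval2 g x y \<ge> 0 \<Longrightarrow>
      (\<Sum>k<l. (eval2 (A k) x y + \<sigma> * eval2 (B k) x y * sqrt (eval2 g x y)) ^ (2 * s)) =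
      (\<Sum>t\<in>T. eval2 (tangent_prod (T - {t})) x y ^ (2 * s))"
  shows "card T \<le> 3 ^ l"
proof (rule ccontr)
  assume "\<not> card T \<le> 3 ^ l"
  then have card: "card T > 3 ^ l" by simp
  define G where "G t x = eval2 (tangent_prod (T - {t})) x (t * x - t\<^sup>2)" for t x
  have on_tangent: "(\<Sum>t'\<in>T. eval2 (tangent_prod (T - {t'})) x (t * x - t\<^sup>2) ^ (2 * s)) = G t x ^ (2 * s)"
    if "t \<in> T" for t x
  proof -
    have "eval2 (tangent_prod (T - {t'})) x (t * x - t\<^sup>2) = 0" if "t' \<in> T - {t}" for t'
      unfolding eval2_tangent_prod_tangent using \<open>t \<in> T\<close> that T(1) by (auto intro: prod_zero)
    then show ?thesis
      using s that by (simp add: sum.remove[OF T(1) that] G_def)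
  qed
  \<comment> \<open>For x \<ge> t the ordinate t (x - t) lies between 0 and x^2, inside the region
    of growth.\<close>
  have g_pos: "\<kappa> * x \<le> eval2 g x (t * x - t\<^sup>2)" if "t \<in> T" "x \<ge> t" for t x
  proof (rule growth)
    have t: "t \<ge> 1" "t \<ge> r" using T that by auto
    then show "x \<ge> r" using that by simp
    have "0 \<le> t * (x - t)" using t that by auto
    moreover have "t * x \<le> x * x" using t that by (intro mult_right_mono) auto
    ultimately show "\<bar>t * x - t\<^sup>2\<bar> \<le> x\<^sup>2" using zero_le_square[of t] zero_le_square[of x]
      unfolding power2_eq_square right_diff_distrib by linarith
  qed
  \<comment> \<open>All terms are even powers, so each is at most the whole sum.\<close>
  have term_le: "\<bar>eval2 (A k) x (t * x - t\<^sup>2) + \<sigma> * eval2 (B k) x (t * x - t\<^sup>2) * sqrt (eval2 g x (t * x - t\<^sup>2))\<bar> \<le> \<bar>G t x\<bar>"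
    if "k < l" "t \<in> T" "x \<ge> t" "\<sigma>\<^sup>2 = 1" for k t x \<sigma>
  proof -
    let ?y = "t * x - t\<^sup>2"
    let ?h = "\<lambda>k. (eval2 (A k) x ?y + \<sigma> * eval2 (B k) x ?y * sqrt (eval2 g x ?y)) ^ (2 * s)"
    have "x \<ge> 0" using T(2)[OF that(2)] that by simp
    then have "eval2 g x ?y \<ge> 0" using g_pos[OF that(2,3)] \<kappa> by (smt (verit) mult_nonneg_nonneg)
    then have "(\<Sum>k<l. ?h k) = G t x ^ (2 * s)"
      using eq[OF that(4)] on_tangent[OF that(2)] by simp
    moreover have "?h k \<le> (\<Sum>k<l. ?h k)" using that(1) by (intro member_le_sum) auto
    ultimately have "\<bar>eval2 (A k) x ?y + \<sigma> * eval2 (B k) x ?y * sqrt (eval2 g x ?y)\<bar> ^ (2 * s) \<le> \<bar>G t x\<bar> ^ (2 * s)"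
      by (simp add: power_even_abs)
    then show ?thesis using s by (subst (asm) power_mono_iff) auto
  qed
  have A_le: "\<bar>eval2 (A k) x (t * x - t\<^sup>2)\<bar> \<le> \<bar>G t x\<bar>"
    and B_le: "\<bar>eval2 (B k) x (t * x - t\<^sup>2)\<bar> * sqrt (\<kappa> * x) \<le> \<bar>G t x\<bar>"
    if "k < l" "t \<in> T" "x \<ge> t" for k t x
  proof -
    let ?y = "t * x - t\<^sup>2"
    let ?b = "eval2 (B k) x ?y * sqrt (eval2 g x ?y)"
    \<comment> \<open>Bounds for both the sum and the difference bound each of the two
      parts.\<close>
    have pm: "\<bar>eval2 (A k) x ?y + ?b\<bar> \<le> \<bar>G t x\<bar>" "\<bar>eval2 (A k) x ?y - ?b\<bar> \<le> \<bar>G t x\<bar>"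
      using term_le[OF that, of 1] term_le[OF that, of "-1"] by simp_all
    from pm show "\<bar>eval2 (A k) x ?y\<bar> \<le> \<bar>G t x\<bar>" by (simp add: abs_le_iff)
    have "\<bar>eval2 (B k) x ?y\<bar> * sqrt (\<kappa> * x) \<le> \<bar>eval2 (B k) x ?y\<bar> * sqrt (eval2 g x ?y)"
      using g_pos[OF that(2,3)] by (intro mult_left_mono) auto
    also have "\<dots> \<le> \<bar>?b\<bar>" by (simp add: abs_mult mult_left_mono)
    also have "\<dots> \<le> \<bar>G t x\<bar>" using pm by (simp add: abs_le_iff)
    finally show "\<bar>eval2 (B k) x ?y\<bar> * sqrt (\<kappa> * x) \<le> \<bar>G t x\<bar>" .
  qed
  \<comment> \<open>The restriction of the product for \<open>t\<close> to its own tangent is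
    \<open>w t\<close> times the monic \<open>P t\<close>. Dividing by \<open>w t\<close> normalises
    the coefficients \<open>a k t\<close> below.\<close>
  define P where "P t = (\<Prod>j\<in>T - {t}. [:- (t + j), 1:])" for t
  define w where "w t = (\<Prod>j\<in>T - {t}. (t - j))" for t
  have w0: "w t \<noteq> 0" for t using T(1) by (auto simp: w_def)
  have G: "G t x = w t * poly (P t) x" for t x
    by (simp add: G_def eval2_tangent_prod_tangent w_def P_def poly_prod algebra_simps)
  have "\<exists>a. poly (A k) [:- (t\<^sup>2), t:] = smult (a * w t) (P t)" if "k < l" "t \<in> T" for k t
  proof -
    have "\<bar>eval2 (A k) x (t * x - t\<^sup>2)\<bar> \<le> 1 * \<bar>eval2 (tangent_prod (T - {t})) x (t * x - t\<^sup>2)\<bar>" if "x \<ge> t" for x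
      using A_le[OF \<open>k < l\<close> \<open>t \<in> T\<close> that] by (simp add: G_def)
    then obtain a where "poly (A k) [:- (t\<^sup>2), t:] = smult a (\<Prod>j\<in>T - {t}. [:- (t + j), 1:])"
      using poly_tangent_dominated[of "T - {t}" t "A k" 1] T by (meson DiffD1 finite_Diff order_trans zero_le_one)
    then have "poly (A k) [:- (t\<^sup>2), t:] = smult (a / w t * w t) (P t)" using w0 by (simp add: P_def)
    then show ?thesis by blast
  qed
  then obtain a where A: "\<And>k t. k < l \<Longrightarrow> t \<in> T \<Longrightarrow> poly (A k) [:- (t\<^sup>2), t:] = smult (a k t * w t) (P t)"
    by metis
  have B: "poly (B k) [:- (t\<^sup>2), t:] = 0" if "k < l" "t \<in> T" for k t
  proof -
    have t: "t \<ge> 1" using T that by simp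
    have "\<bar>eval2 (B k) x (t * x - t\<^sup>2)\<bar> \<le> 1 / sqrt \<kappa> * \<bar>eval2 (tangent_prod (T - {t})) x (t * x - t\<^sup>2)\<bar>" if "x \<ge> t" for x
    proof -
      have "\<bar>eval2 (B k) x (t * x - t\<^sup>2)\<bar> * sqrt \<kappa> \<le> \<bar>eval2 (B k) x (t * x - t\<^sup>2)\<bar> * sqrt (\<kappa> * x)"
        using \<kappa> t that by (intro mult_left_mono) auto
      also have "\<dots> \<le> \<bar>G t x\<bar>" using \<open>k < l\<close> \<open>t \<in> T\<close> that by (rule B_le)
      finally show ?thesis using \<kappa> by (simp add: G_def field_simps)
    qed
    then obtain b where b: "poly (B k) [:- (t\<^sup>2), t:] = smult b (P t)"
      using poly_tangent_dominated[of "T - {t}" t "B k" "1 / sqrt \<kappa>"] T unfolding P_def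
      by (meson DiffD1 finite_Diff order_trans zero_le_one)
    \<comment> \<open>Past all roots t + j, and far enough that the growth of sqrt(\<kappa> x)
      contradicts b \<noteq> 0. For b = 0 the quotient is 0 by convention and the point is still
      past the roots.\<close>
    define x where "x = Max T + t + 1 + (w t)\<^sup>2 / (b\<^sup>2 * \<kappa>)"
    have mx: "\<And>j. j \<in> T \<Longrightarrow> j \<le> Max T" using T(1) by simp
    have x: "x \<ge> Max T + t + 1" unfolding x_def using \<kappa> by simp
    have xt: "x \<ge> t" using x mx[OF that(2)] t by linarith
    have "x - (t + j) \<noteq> 0" if "j \<in> T" for j using x mx[OF that] by linarith
    moreover have "poly (P t) x = (\<Prod>j\<in>T - {t}. (x - (t + j)))"
      by (simp add: P_def poly_prod algebra_simps)
    ultimately have "poly (P t) x \<noteq> 0" using T(1) by simp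
    moreover have "\<bar>b * poly (P t) x\<bar> * sqrt (\<kappa> * x) \<le> \<bar>w t * poly (P t) x\<bar>"
      using B_le[OF that xt] arg_cong[OF b, of "\<lambda>p. poly p x"] by (simp add: poly_poly_eq_eval2 G algebra_simps)
    ultimately have "\<bar>b\<bar> * sqrt (\<kappa> * x) \<le> \<bar>w t\<bar>"
      by (simp add: abs_mult mult.assoc mult.commute[of _ "sqrt _"] mult.left_commute[of _ "sqrt _"])
    then have "(\<bar>b\<bar> * sqrt (\<kappa> * x))\<^sup>2 \<le> \<bar>w t\<bar>\<^sup>2" by (intro power_mono) (use xt t \<kappa> in auto)
    then have le: "b\<^sup>2 * (\<kappa> * x) \<le> (w t)\<^sup>2" using xt t \<kappa> by (simp add: power_mult_distrib)
    have "b = 0"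
    proof (rule ccontr)
      assume "b \<noteq> 0"
      then have pos: "b\<^sup>2 * \<kappa> > 0" using \<kappa> by simp
      have "x > (w t)\<^sup>2 / (b\<^sup>2 * \<kappa>)" unfolding x_def using mx[OF that(2)] t by linarith
      then have "(w t)\<^sup>2 < b\<^sup>2 * \<kappa> * x" using pos by (simp add: field_simps)
      with le show False by (simp add: mult.assoc)
    qed
    with b show ?thesis by simp
  qed
  \<comment> \<open>Compare at (t, 0), a point of the tangent where \<open>G t t\<close> is nonzero
    because all slopes are positive.\<close>
  have one: "(\<Sum>k<l. a k t ^ (2 * s)) = 1" if "t \<in> T" for t
  proof -
    have "G t t \<noteq> 0" unfolding G using w0[of t] T by (force simp: P_def poly_prod)
    have A': "eval2 (A k) t 0 = a k t * G t t" if "k < l" for k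
      using arg_cong[OF A[OF that \<open>t \<in> T\<close>], of "\<lambda>p. poly p t"]
      by (simp add: poly_poly_eq_eval2 G power2_eq_square)
    have B': "eval2 (B k) t 0 = 0" if "k < l" for k
      using arg_cong[OF B[OF that \<open>t \<in> T\<close>], of "\<lambda>p. poly p t"]
      by (simp add: poly_poly_eq_eval2 power2_eq_square)
    have "t \<ge> 1" using T that by simp
    then have "eval2 g t 0 \<ge> 0" using g_pos[OF that order_refl] \<kappa>
      by (simp add: power2_eq_square) (smt (verit) mult_nonneg_nonneg)
    then have "(\<Sum>k<l. (a k t * G t t) ^ (2 * s)) = G t t ^ (2 * s)"
      using eq[of 1 t 0] on_tangent[OF that, of t] A' B' by (simp add: power2_eq_square)
    then have "(\<Sum>k<l. a k t ^ (2 * s)) * G t t ^ (2 * s) = 1 * G t t ^ (2 * s)"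
      by (simp add: power_mult_distrib sum_distrib_right)
    then show ?thesis using \<open>G t t \<noteq> 0\<close> by simp
  qed
  obtain t u where tu: "t \<in> T" "u \<in> T" "t \<noteq> u" and sgn: "\<And>k. k < l \<Longrightarrow> sgn (a k t) = sgn (a k u)"
    using exists_same_sgn_pattern[OF T(1) card] by blast
  define S where "S = T - {t, u}"
  have S: "finite S" "t \<notin> S" "u \<notin> S" "T - {t} = insert u S" "T - {u} = insert t S"
    using T(1) tu by (auto simp: S_def)
  define W where "W = (\<Prod>j\<in>S. (t - j)) * (\<Prod>j\<in>S. (u - j))"
  have "W \<noteq> 0" using S by (auto simp: W_def)
  have "\<exists>D. (\<forall>y. eval2 (A k) (t + u) y = (y - t * u) * eval2 D (t + u) y) \<and>
      eval2 D (t + u) (t * u) = W * (a k t + a k u)" if k: "k < l" for k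
  proof -
    obtain D where D: "\<And>y. eval2 (A k) (t + u) y = (y - t * u) * eval2 D (t + u) y"
      "(t - u) * eval2 D (t + u) (t * u) = a k t * w t * (\<Prod>j\<in>S. (u - j)) - a k u * w u * (\<Prod>j\<in>S. (t - j))"
      using vertical_quotient_at_intersection[OF S(1-3) tu(3)] A[OF k tu(1)] A[OF k tu(2)]
      unfolding P_def S by metis
    \<comment> \<open>\<open>w t\<close> contains t - u and \<open>w u\<close> contains u - t. These
      opposite signs turn the difference into a sum of coefficients.\<close>
    have "(t - u) * eval2 D (t + u) (t * u) = (t - u) * (W * (a k t + a k u))"
      unfolding D(2) w_def S W_def using S by (simp add: algebra_simps)
    then show ?thesis using D(1) tu(3) by auto
  qed
  then obtain D where D: "\<And>k y. k < l \<Longrightarrow> eval2 (A k) (t + u) y = (y - t * u) * eval2 (D k) (t + u) y"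
      "\<And>k. k < l \<Longrightarrow> eval2 (D k) (t + u) (t * u) = W * (a k t + a k u)"
    by metis
  have "\<exists>E. (\<forall>y. eval2 (B k) (t + u) y = (y - t * u) * eval2 E (t + u) y) \<and>
      eval2 E (t + u) (t * u) = 0" if k: "k < l" for k
  proof -
    obtain E where E: "\<And>y. eval2 (B k) (t + u) y = (y - t * u) * eval2 E (t + u) y"
      "(t - u) * eval2 E (t + u) (t * u) = 0 * (\<Prod>j\<in>S. (u - j)) - 0 * (\<Prod>j\<in>S. (t - j))"
      using vertical_quotient_at_intersection[OF S(1-3) tu(3), of "B k" 0 0] B[OF k tu(1)] B[OF k tu(2)]
      by (metis smult_0_left)
    then show ?thesis using tu(3) by auto
  qed
  then obtain E where E: "\<And>k y. k < l \<Longrightarrow> eval2 (B k) (t + u) y = (y - t * u) * eval2 (E k) (t + u) y"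
      "\<And>k. k < l \<Longrightarrow> eval2 (E k) (t + u) (t * u) = 0"
    by metis
  \<comment> \<open>Products omitting a third tangent contain both forms through the point, hence
    have a double zero along the vertical line.\<close>
  have "\<exists>H. \<forall>y. eval2 (tangent_prod (T - {j})) (t + u) y = (y - t * u)\<^sup>2 * eval2 H (t + u) y" if "j \<in> S" for j
  proof -
    have "T - {j} = insert t (insert u (S - {j}))" using tu that by (auto simp: S_def)
    moreover have "eval2 (tangent_prod (insert t (insert u (S - {j})))) (t + u) y =
      (y - t * u)\<^sup>2 * eval2 (tangent_prod (S - {j})) (t + u) y" for y
      using S tu unfolding eval2_tangent_prod by (simp add: algebra_simps power2_eq_square)
    ultimately show ?thesis by metis
  qed
  then obtain H where H: "\<And>j y. j \<in> S \<Longrightarrow> eval2 (tangent_prod (T - {j})) (t + u) y = (y - t * u)\<^sup>2 * eval2 (H j) (t + u) y"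
    by metis
  \<comment> \<open>The difference of the two sides on the line x = t + u, divided by (y - t
    u)^(2s).\<close>
  define h where "h y = (\<Sum>k<l. (eval2 (D k) (t + u) y + eval2 (E k) (t + u) y * sqrt (eval2 g (t + u) y)) ^ (2 * s))
    - (eval2 (tangent_prod S) (t + u) y ^ (2 * s) + eval2 (tangent_prod S) (t + u) y ^ (2 * s) + (\<Sum>j\<in>S. ((y - t * u) * eval2 (H j) (t + u) y) ^ (2 * s)))" for y
  have T_split: "(\<Sum>j\<in>T. q j) = q t + q u + (\<Sum>j\<in>S. q j)" for q :: "real \<Rightarrow> real"
    using S tu T(1) by (simp add: sum.remove[OF T(1) tu(1)])
  have h0: "h y = 0" if y: "\<bar>y\<bar> < (t + u)\<^sup>2" "y \<noteq> t * u" for y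
  proof -
    let ?e = "(y - t * u) ^ (2 * s)"
    have "t \<ge> 1" "u \<ge> 1" "t \<ge> r" using T tu by auto
    then have "eval2 g (t + u) y \<ge> 0"
      using growth[of "t + u" y] y \<kappa> by (smt (verit) mult_nonneg_nonneg)
    from eq[of 1, OF _ this]
    have "(\<Sum>k<l. ((y - t * u) * (eval2 (D k) (t + u) y + eval2 (E k) (t + u) y * sqrt (eval2 g (t + u) y))) ^ (2 * s)) =
      ((y - t * u) * eval2 (tangent_prod S) (t + u) y) ^ (2 * s) +
      ((y - t * u) * eval2 (tangent_prod S) (t + u) y) ^ (2 * s) +
      (\<Sum>j\<in>S. ((y - t * u)\<^sup>2 * eval2 (H j) (t + u) y) ^ (2 * s))"
      using eval2_tangent_prod_insert[OF S(1,2), of u y] eval2_tangent_prod_insert[OF S(1,3), of t y]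
      by (simp add: T_split S D(1) E(1) H distrib_left mult.assoc add.commute[of u t] mult.commute[of u t])
    then have "?e * h y = 0"
      unfolding h_def power2_eq_square right_diff_distrib[of ?e] distrib_left[of ?e] sum_distrib_left
        mult.assoc power_mult_distrib[of "y - t * u"] by (simp only: diff_self)
    then show ?thesis using y by simp
  qed
  have "h (t * u) = 0"
  proof (rule isCont_eq_zero_of_eventually[of "t * u" h])
    show "isCont h (t * u)"
      unfolding h_def by (intro continuous_intros isCont_eval2)
    have "t \<ge> 1" "u \<ge> 1" using T tu by auto
    \<comment> \<open>The intersection point is interior to the region where \<open>g\<close> is
      nonnegative, so the identity holds on both sides of it.\<close>
    then have "\<bar>t * u\<bar> < (t + u)\<^sup>2"
      by (simp add: power2_eq_square algebra_simps) (smt (verit) mult_pos_pos)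
    moreover have "open {y. \<bar>y\<bar> < (t + u)\<^sup>2}" by (intro open_Collect_less continuous_intros)
    ultimately have "\<forall>\<^sub>F y in at (t * u). y \<in> {y. \<bar>y\<bar> < (t + u)\<^sup>2}" 
      by (intro eventually_at_topological[THEN iffD2]) auto
    moreover have "\<forall>\<^sub>F y in at (t * u). y \<noteq> t * u" by (simp add: eventually_at_filter)
    ultimately show "\<forall>\<^sub>F y in at (t * u). h y = 0" by eventually_elim (use h0 in auto)
  qed
  \<comment> \<open>The terms from \<open>S\<close> keep a factor y - t u and vanish; the tangents
    \<open>t\<close> and \<open>u\<close> contribute W^(2s) each.\<close>
  then have "(\<Sum>k<l. (W * (a k t + a k u)) ^ (2 * s)) = 2 * W ^ (2 * s)"
    using s by (simp add: h_def D(2) E(2) W_def eval2_tangent_prod_intersection)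
  then have two: "(\<Sum>k<l. (a k t + a k u) ^ (2 * s)) = 2"
    using \<open>W \<noteq> 0\<close> by (simp add: power_mult_distrib flip: sum_distrib_left)
  \<comment> \<open>Some coefficient is nonzero since the powers sum to 1; this makes one inequality
    strict and yields 2 < 2.\<close>
  have "\<exists>k<l. a k t \<noteq> 0"
    using one[OF tu(1)] s by (intro ccontr[of "\<exists>k<l. a k t \<noteq> 0"]) (simp add: power_0_left)
  then have "(\<Sum>k<l. a k t ^ (2 * s) + a k u ^ (2 * s)) < (\<Sum>k<l. (a k t + a k u) ^ (2 * s))"
    using power_sum_le_power_add_same_sgn[OF sgn s] by (intro sum_strict_mono_ex1) auto
  then show False using one[OF tu(1)] one[OF tu(2)] two by (simp add: sum.distrib)
qed

subsection \<open>The ring with a square root adjoined\<close>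

lemma abelian_monoid_sqrt_ring: "abelian_monoid (sqrt_ring f)"
  by (unfold_locales) (auto simp: sqrt_ring_def algebra_simps)

lemma sqrt_ring_finsum:
  fixes n :: nat
  shows "finsum (sqrt_ring f) h {..<n} = ((\<Sum>i<n. fst (h i)), (\<Sum>i<n. snd (h i)))"
proof (induction n)
  case 0
  interpret abelian_monoid "sqrt_ring f" by (rule abelian_monoid_sqrt_ring)
  show ?case unfolding lessThan_0 finsum_empty by (simp add: sqrt_ring_def)
next
  case (Suc n)
  interpret abelian_monoid "sqrt_ring f" by (rule abelian_monoid_sqrt_ring)
  have "finsum (sqrt_ring f) h {..<Suc n} = h n \<oplus>\<^bsub>sqrt_ring f\<^esub> finsum (sqrt_ring f) h {..<n}"
    unfolding lessThan_Suc by (rule finsum_insert) (auto simp: sqrt_ring_def)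
  also have "\<dots> = ((\<Sum>i<Suc n. fst (h i)), (\<Sum>i<Suc n. snd (h i)))"
    unfolding Suc by (simp add: sqrt_ring_def split: prod.splits)
  finally show ?case .
qed

lemma sqrt_ring_pow_base: "(p, 0) [^]\<^bsub>sqrt_ring f\<^esub> (n::nat) = (p ^ n, 0)"
  by (induction n) (simp_all add: nat_pow_def sqrt_ring_def)

text \<open>Evaluation of \<open>\<phi>(a) + \<phi>(b) \<sigma> \<surd>g\<close> at a point where \<open>g = \<phi> f\<close> is nonnegative,
  for either choice \<open>\<sigma> = \<plusminus>1\<close> of the sign, is a ring homomorphism to the reals.\<close>

definition sqrt_eval :: "(bipoly \<Rightarrow> bipoly) \<Rightarrow> bipoly \<Rightarrow> real \<Rightarrow> real \<Rightarrow> real \<Rightarrow> bipoly \<times> bipoly \<Rightarrow> real" where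
  "sqrt_eval \<phi> f \<sigma> x y p = eval2 (\<phi> (fst p)) x y + \<sigma> * eval2 (\<phi> (snd p)) x y * sqrt (eval2 (\<phi> f) x y)"

lemma bipoly_hom_simps:
  assumes "bipoly_hom \<phi>"
  shows "\<phi> (A + B) = \<phi> A + \<phi> B" "\<phi> (A * B) = \<phi> A * \<phi> B" "\<phi> 0 = 0" "\<phi> 1 = 1"
proof -
  show "\<phi> (A + B) = \<phi> A + \<phi> B" "\<phi> (A * B) = \<phi> A * \<phi> B"
    using assms by (auto simp: bipoly_hom_def)
  have c: "\<phi> [:[:a:]:] = [:[:a:]:]" for a using assms by (auto simp: bipoly_hom_def)
  show "\<phi> 0 = 0" using c[of 0] by simp
  show "\<phi> 1 = 1" using c[of 1] by (simp flip: one_pCons)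
qed

lemma bipoly_hom_power: "bipoly_hom \<phi> \<Longrightarrow> \<phi> (A ^ n) = \<phi> A ^ n"
  by (induction n) (simp_all add: bipoly_hom_simps)

lemma bipoly_hom_sum:
  assumes "bipoly_hom \<phi>" shows "\<phi> (\<Sum>i\<in>I. F i) = (\<Sum>i\<in>I. \<phi> (F i))"
  by (induction I rule: infinite_finite_induct) (simp_all add: bipoly_hom_simps[OF assms])

lemma sqrt_eval_power:
  assumes \<phi>: "bipoly_hom \<phi>" and \<sigma>: "\<sigma>\<^sup>2 = 1" and nn: "eval2 (\<phi> f) x y \<ge> 0"
  shows "sqrt_eval \<phi> f \<sigma> x y (p [^]\<^bsub>sqrt_ring f\<^esub> (n::nat)) = sqrt_eval \<phi> f \<sigma> x y p ^ n"
proof (induction n)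
  case 0
  show ?case by (simp add: nat_pow_def sqrt_ring_def sqrt_eval_def bipoly_hom_simps[OF \<phi>])
next
  case (Suc n)
  have "sqrt_eval \<phi> f \<sigma> x y (p \<otimes>\<^bsub>sqrt_ring f\<^esub> q) = sqrt_eval \<phi> f \<sigma> x y p * sqrt_eval \<phi> f \<sigma> x y q" for p q
  proof -
    define r where "r = sqrt (eval2 (\<phi> f) x y)"
    have r: "eval2 (\<phi> f) x y = r * r" using nn by (simp add: r_def)
    have \<sigma>': "\<sigma> * (\<sigma> * z) = z" for z using \<sigma> by (simp add: power2_eq_square flip: mult.assoc)
    obtain a b c d where pq: "p = (a, b)" "q = (c, d)" by fastforce
    show ?thesis
      by (simp add: sqrt_eval_def pq sqrt_ring_def bipoly_hom_simps[OF \<phi>] r_def[symmetric])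
         (simp add: r algebra_simps \<sigma>')
  qed
  then show ?case using Suc by (simp add: nat_pow_def mult.commute)
qed

lemma sqrt_eval_finsum:
  assumes "bipoly_hom \<phi>"
  shows "sqrt_eval \<phi> f \<sigma> x y (finsum (sqrt_ring f) h {..<n :: nat}) = (\<Sum>i<n. sqrt_eval \<phi> f \<sigma> x y (h i))"
  by (simp add: sqrt_ring_finsum sqrt_eval_def bipoly_hom_sum[OF assms] sum.distrib sum_distrib_left sum_distrib_right)

text \<open>Surjectivity of \<phi> lifts the tangent products to the original coordinates, while all
  estimates are made after applying \<phi>.\<close>

lemma pythagoras_number_sqrt_ring_infinite:
  assumes s: "s \<ge> 1" and \<phi>: "bipoly_hom \<phi>" "surj \<phi>" and \<kappa>: "\<kappa> > 0"
    and growth: "\<And>x y. x \<ge> r \<Longrightarrow> \<bar>y\<bar> \<le> x\<^sup>2 \<Longrightarrow> \<kappa> * x \<le> eval2 (\<phi> f) x y"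
  shows "pythagoras_number (sqrt_ring f) (2 * s) = \<infinity>"
proof -
  have False if l: "\<And>x. x \<in> carrier (sqrt_ring f) \<Longrightarrow> sum_of_powers (sqrt_ring f) (2 * s) x \<Longrightarrow>
      sum_of_powers_le (sqrt_ring f) (2 * s) l x" for l
  proof -
    define n where "n = 3 ^ l + (1 :: nat)"
    \<comment> \<open>Distinct slopes, all at least 1 and at least \<open>r\<close>; their number
      3^l + 1 is just beyond the bound for \<open>l\<close> powers.\<close>
    define \<tau> where "\<tau> i = max 1 r + real i" for i :: nat
    define T where "T = \<tau> ` {..<n}"
    have inj: "inj_on \<tau> {..<n}" by (auto simp: inj_on_def \<tau>_def)
    have T: "finite T" "\<And>t. t \<in> T \<Longrightarrow> t \<ge> 1" "\<And>t. t \<in> T \<Longrightarrow> t \<ge> r" "card T = n"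
      using card_image[OF inj] by (auto simp: T_def) (auto simp: \<tau>_def)
    obtain h where h: "\<And>A. \<phi> (h A) = A" using \<phi>(2) by (metis surjD)
    define F where "F = finsum (sqrt_ring f) (\<lambda>i. (h (tangent_prod (T - {\<tau> i})), 0) [^]\<^bsub>sqrt_ring f\<^esub> (2 * s)) {..<n}"
    have "sum_of_powers (sqrt_ring f) (2 * s) F"
      unfolding sum_of_powers_def sum_of_powers_le_def F_def
      by (intro exI[of _ n] exI[of _ "\<lambda>i. (h (tangent_prod (T - {\<tau> i})), 0)"] conjI refl order_refl)
         (simp add: sqrt_ring_def)
    then have "sum_of_powers_le (sqrt_ring f) (2 * s) l F"
      by (intro l) (simp_all add: sqrt_ring_def)
    then obtain k q where k: "k \<le> l" and q: "F = finsum (sqrt_ring f) (\<lambda>i. q i [^]\<^bsub>sqrt_ring f\<^esub> (2 * s)) {..<k}"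
      unfolding sum_of_powers_le_def by blast
    have eq: "(\<Sum>i<k. (eval2 (\<phi> (fst (q i))) x y + \<sigma> * eval2 (\<phi> (snd (q i))) x y * sqrt (eval2 (\<phi> f) x y)) ^ (2 * s)) =
      (\<Sum>t\<in>T. eval2 (tangent_prod (T - {t})) x y ^ (2 * s))"
      if "\<sigma>\<^sup>2 = 1" "eval2 (\<phi> f) x y \<ge> 0" for x y \<sigma>
    proof -
      have "(\<Sum>i<k. sqrt_eval \<phi> f \<sigma> x y (q i) ^ (2 * s)) = sqrt_eval \<phi> f \<sigma> x y F"
        unfolding q sqrt_eval_finsum[OF \<phi>(1)] sqrt_eval_power[OF \<phi>(1) that] ..
      also have "\<dots> = (\<Sum>i<n. eval2 (tangent_prod (T - {\<tau> i})) x y ^ (2 * s))"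
        unfolding F_def sqrt_eval_finsum[OF \<phi>(1)] sqrt_eval_power[OF \<phi>(1) that]
        by (simp add: sqrt_eval_def h bipoly_hom_simps[OF \<phi>(1)])
      also have "\<dots> = (\<Sum>t\<in>T. eval2 (tangent_prod (T - {t})) x y ^ (2 * s))"
        unfolding T_def by (simp add: sum.reindex[OF inj])
      finally show ?thesis by (simp add: sqrt_eval_def)
    qed
    have "card T \<le> 3 ^ k"
      using s \<kappa> growth T(1-3) eq by (rule tangent_power_sum_length)
    also have "\<dots> \<le> 3 ^ l" using k by (intro power_increasing) auto
    finally show False using T(4) by (simp add: n_def)
  qed
  then have "\<not> (\<exists>l>0. \<forall>x\<in>carrier (sqrt_ring f). sum_of_powers (sqrt_ring f) (2 * s) x \<longrightarrow>
      sum_of_powers_le (sqrt_ring f) (2 * s) l x)" by blast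
  then show ?thesis by (simp only: pythagoras_number_def Let_def if_False)
qed

section \<open>Change of coordinates and conclusion\<close>

theorem mainTheorem7:
  fixes f :: bipoly and s :: nat
  assumes "nonconstant2 f" and "eval2 f 0 0 = 0"
    and "admissible f"
    and "\<not> (\<exists>g :: bipoly. f = g ^ 2)"
    and "s \<ge> 1"
  shows "pythagoras_number (sqrt_ring f) (2 * s) = \<infinity>"
proof -
  obtain m11 m12 m21 m22 where det: "m11 * m22 - m12 * m21 \<noteq> 0"
    and sadm: "strictly_admissible (compose_lin f m11 m12 m21 m22)"
    using assms(3) by (auto simp: admissible_def)
  obtain \<epsilon> \<delta> \<kappa> r N where sq: "\<epsilon>\<^sup>2 = 1" "\<delta>\<^sup>2 = 1" and \<kappa>: "\<kappa> > 0"
    and growth: "\<And>x y. x \<ge> r \<Longrightarrow> \<bar>y\<bar> \<le> x\<^sup>2 \<Longrightarrow>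
      \<kappa> * x \<le> eval2 (compose_lin f m11 m12 m21 m22) (\<epsilon> * x) (\<delta> * (y + x ^ N))"
    using strictly_admissible_growth[OF sadm] by metis
  define C where "C a = [:[:a:]:]" for a :: real
  define \<phi>1 where "\<phi>1 A = compose_lin A m11 m12 m21 m22" for A
  \<comment> \<open>Pullback along the sign changes and the shear by x^N; applied after
    \<open>\<phi>1\<close>, it gives the polynomial bounded below in \<open>growth\<close>.\<close>
  define \<phi>2 where "\<phi>2 A = subst2 A (C \<epsilon> * polyX) (C \<delta> * (polyY + polyX ^ N))" for A
  have C: "C a * C b = C (a * b)" "C 1 = 1" "C a + C b = C (a + b)" "C 0 = 0" "- C a = C (- a)" for a b
    by (simp_all add: C_def one_pCons)
  have hom1: "bipoly_hom \<phi>1" unfolding \<phi>1_def compose_lin_def by (rule bipoly_hom_subst2)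
  have hom2: "bipoly_hom \<phi>2" unfolding \<phi>2_def by (rule bipoly_hom_subst2)
  have hC: "\<phi> (C a) = C a" if "bipoly_hom \<phi>" for \<phi> a using that by (simp add: bipoly_hom_def C_def)
  have surj1: "surj \<phi>1"
  proof (rule surj_bipoly_hom[OF hom1])
    define D where "D = m11 * m22 - m12 * m21"
    have D: "D \<noteq> 0" using det by (simp add: D_def)
    have smult_C: "smult [:a:] p = C a * p" for a p by (simp add: C_def)
    have X: "\<phi>1 polyX = C m11 * polyX + C m12 * polyY" and Y: "\<phi>1 polyY = C m21 * polyX + C m22 * polyY"
      by (simp_all add: \<phi>1_def compose_lin_def subst2_X subst2_Y smult_C)
    have lin: "\<phi>1 (C a * polyX + C b * polyY) = C (a * m11 + b * m21) * polyX + C (a * m12 + b * m22) * polyY" for a b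
      by (simp add: bipoly_hom_simps[OF hom1] hC[OF hom1] X Y C(1,3)[symmetric] algebra_simps)
    \<comment> \<open>The coefficients are the rows of the inverse matrix.\<close>
    have inv: "m22 / D * m11 + - m12 / D * m21 = 1" "m22 / D * m12 + - m12 / D * m22 = 0"
      "- m21 / D * m11 + m11 / D * m21 = 0" "- m21 / D * m12 + m11 / D * m22 = 1"
      using D by (simp_all add: field_simps) (simp_all add: D_def algebra_simps)
    show "polyX \<in> range \<phi>1"
      using lin[of "m22 / D" "- m12 / D"] unfolding inv by (simp add: C) (metis rangeI)
    show "polyY \<in> range \<phi>1"
      using lin[of "- m21 / D" "m11 / D"] unfolding inv by (simp add: C) (metis rangeI)
  qed
  have surj2: "surj \<phi>2"
  proof (rule surj_bipoly_hom[OF hom2])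
    have X: "\<phi>2 polyX = C \<epsilon> * polyX" and Y: "\<phi>2 polyY = C \<delta> * (polyY + polyX ^ N)"
      by (simp_all add: \<phi>2_def subst2_X subst2_Y)
    have sq': "C \<epsilon> * (C \<epsilon> * p) = p" "C \<delta> * (C \<delta> * p) = p" for p
      using sq by (simp_all add: C power2_eq_square flip: mult.assoc)
    have X': "\<phi>2 (C \<epsilon> * polyX) = polyX"
      by (simp add: bipoly_hom_simps[OF hom2] hC[OF hom2] X sq')
    then show "polyX \<in> range \<phi>2" by (metis rangeI)
    \<comment> \<open>As \<delta>^2 = 1, the first summand is sent to y + x^N; the second removes
      x^N.\<close>
    have "\<phi>2 (C \<delta> * polyY + C (- 1) * (C \<epsilon> * polyX) ^ N) =
        C \<delta> * \<phi>2 polyY + C (- 1) * \<phi>2 (C \<epsilon> * polyX) ^ N"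
      by (simp only: bipoly_hom_simps(1,2)[OF hom2] bipoly_hom_power[OF hom2] hC[OF hom2])
    also have "\<dots> = polyY" using C(5)[of 1, symmetric] by (simp add: X' Y sq' C(2))
    finally have "\<phi>2 (C \<delta> * polyY + C (- 1) * (C \<epsilon> * polyX) ^ N) = polyY" .
    then show "polyY \<in> range \<phi>2" by (metis rangeI)
  qed
  show ?thesis
  proof (rule pythagoras_number_sqrt_ring_infinite[OF assms(5) _ _ \<kappa>])
    show "bipoly_hom (\<phi>2 \<circ> \<phi>1)" using hom1 hom2 by (simp add: bipoly_hom_def)
    show "surj (\<phi>2 \<circ> \<phi>1)" using surj1 surj2 by (intro comp_surj)
    show "\<kappa> * x \<le> eval2 ((\<phi>2 \<circ> \<phi>1) f) x y" if "x \<ge> r" "\<bar>y\<bar> \<le> x\<^sup>2" for x y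
      using growth[OF that] by (simp add: \<phi>2_def \<phi>1_def eval2_subst2 C_def)
  qed
qed

end
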